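(* Let $\Phi$ and $\Psi$ be sets of formulas of the language $L(\Sigma_2^g)$ of a generalized second-order signature $\Sigma_2^g$. Suppose that for every finite subset $f$ of $\Phi$ the set of formulas $f\cup\{\text{E1–E4}\}\cup\Psi$ has a model $\langle U_f,\gamma_f\rangle$ of signature $\Sigma_2^g$. Then the set of formulas $\Phi\cup\{\text{E1–E4}\}\cup\Psi$ has a model $\langle U,\gamma\rangle$ of signature $\Sigma_2^g$.
   Context: Types: $0$ is the first-order type; for $k\ge0$, $[\tau_0,\ldots,\tau_k]$ with all $\tau_\mu=0$ is a second-order type; for a set $A$, $0(A)=A$, $\check\tau(A)=A^{k+1}$, $\tau(A)=\mathcal P(A^{k+1})$. A generalized second-order signature $\Sigma_2^g$ has a set $\Theta$ of such types (containing $0$ and at least one second-order type), $\Theta_b$ its second-order types, constant symbols $\sigma^\tau_\omega$ ($\omega\in\Omega_\tau$), binary predicate symbols $\delta_\tau$ ($\tau\in\Theta$, generalized equality) and $\varepsilon_\tau$ ($\tau\in\Theta_b$, generalized belonging), and countably many variables of each type. Terms are constants and variables; atomic formulas are $q\,\delta_\tau\,r$ and $(q_0,\ldots,q_k)\,\varepsilon_\tau\,r$ ($\tau=[\tau_0,\ldots,\tau_k]$, $q_\mu$ of type $\tau_\mu$, $r$ of type $\tau$); formulas are built with $\lnot,\land,\lor,\Rightarrow,\exists x^\tau,\forall x^\tau$. A system $U=\langle A,S\rangle$: a set $A$, constants $s^\tau_\omega\in\tau(A)$, relations $\approx_\tau\subseteq\tau(A)^2$ containing the identity, $\tilde\in_\tau\subseteq\check\tau(A)\times\tau(A)$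 containing membership. An evaluation $\gamma$ assigns $\gamma(x^\tau)\in\tau(A)$. Satisfaction: $U\vDash(q\delta_\tau r)[\gamma]$ iff $q[\gamma]\approx_\tau r[\gamma]$; $U\vDash((q_\mu)_\mu\varepsilon_\tau r)[\gamma]$ iff $(q_\mu[\gamma])_\mu\mathrel{\tilde\in_\tau}r[\gamma]$ (constants take value $s^\tau_\omega$); connectives as usual; $U\vDash(\exists x^\tau\psi)[\gamma]$ iff $U\vDash\psi[\gamma']$ for some $\gamma'$ agreeing with $\gamma$ off $x^\tau$; $\forall$ with "every". An evaluated system $\langle U,\gamma\rangle$ is a model for a set of formulas if $U\vDash\varphi[\gamma]$ for each of them. E1–E4 are the equality axioms for all types $\tau\in\Theta$: $\forall x^\tau(x\,\delta_\tau x)$; $\forall x^\tau,y^\tau(x\delta_\tau y\Rightarrow y\delta_\tau x)$; $\forall x^\tau,y^\tau,z^\tau(x\delta_\tau y\land y\delta_\tau z\Rightarrow x\delta_\tau z)$; and, for $\tau=[\tau_0,\ldots,\tau_k]\in\Theta_b$, $\forall x_0,y_0,\ldots,x_k,y_k,u^\tau,v^\tau(x_0\delta_{\tau_0}y_0\land\cdots\land x_k\delta_{\tau_k}y_k\land u\delta_\tau v\Rightarrow((x_0,\ldots,x_k)\varepsilon_\tau u\Leftrightarrow(y_0,\ldots,y_k)\varepsilon_\tau v))$. *)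

theory Defs
  imports Main
begin

text \<open>
  \<open>Obj\<close> is the first-order type \<open>0\<close>. Since all entries of a second-order type are \<open>0\<close>, such a
  type is determined by its length: \<open>Pred k\<close> is \<open>[0, \<dots>, 0]\<close> with \<open>k + 1\<close> entries.
\<close>

datatype so_type = Obj | Pred nat

text \<open>\<open>Theta\<close> is the set of types; \<open>Omega \<tau>\<close> is the index set of the constant symbols of type \<open>\<tau>\<close>.\<close>

record 'w gsignature =
  Theta :: "so_type set"
  Omega :: "so_type \<Rightarrow> 'w set"

definition is_gsignature :: "'w gsignature \<Rightarrow> bool" where
  "is_gsignature \<Sigma> \<longleftrightarrow> Obj \<in> Theta \<Sigma> \<and> (\<exists>k. Pred k \<in> Theta \<Sigma>)"

datatype 'w trm =
    Var so_type nat
  | Cst so_type 'w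

text \<open>
  \<open>Eql \<tau> q r\<close> is \<open>q \<delta>\<^sub>\<tau> r\<close>, and \<open>Bel k [q\<^sub>0, \<dots>, q\<^sub>k] r\<close> is
  \<open>(q\<^sub>0, \<dots>, q\<^sub>k) \<epsilon>\<^sub>\<tau> r\<close> for \<open>\<tau> = Pred k\<close>.
\<close>

datatype 'w form =
    Eql so_type "'w trm" "'w trm"
  | Bel nat "'w trm list" "'w trm"
  | Neg "'w form"
  | Conj "'w form" "'w form"
  | Disj "'w form" "'w form"
  | Imp "'w form" "'w form"
  | Exi so_type nat "'w form"
  | Uni so_type nat "'w form"

definition Iff :: "'w form \<Rightarrow> 'w form \<Rightarrow> 'w form" where
  "Iff \<phi> \<psi> = Conj (Imp \<phi> \<psi>) (Imp \<psi> \<phi>)"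

fun term_of_type :: "'w gsignature \<Rightarrow> so_type \<Rightarrow> 'w trm \<Rightarrow> bool" where
  "term_of_type \<Sigma> \<tau> (Var \<sigma> n) \<longleftrightarrow> \<sigma> = \<tau> \<and> \<tau> \<in> Theta \<Sigma>"
| "term_of_type \<Sigma> \<tau> (Cst \<sigma> \<omega>) \<longleftrightarrow> \<sigma> = \<tau> \<and> \<tau> \<in> Theta \<Sigma> \<and> \<omega> \<in> Omega \<Sigma> \<tau>"

primrec is_formula :: "'w gsignature \<Rightarrow> 'w form \<Rightarrow> bool" where
  "is_formula \<Sigma> (Eql \<tau> q r) \<longleftrightarrow>
     \<tau> \<in> Theta \<Sigma> \<and> term_of_type \<Sigma> \<tau> q \<and> term_of_type \<Sigma> \<tau> r"
| "is_formula \<Sigma> (Bel k qs r) \<longleftrightarrow>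
     Pred k \<in> Theta \<Sigma> \<and> length qs = Suc k \<and> (\<forall>q\<in>set qs. term_of_type \<Sigma> Obj q) \<and>
     term_of_type \<Sigma> (Pred k) r"
| "is_formula \<Sigma> (Neg \<phi>) \<longleftrightarrow> is_formula \<Sigma> \<phi>"
| "is_formula \<Sigma> (Conj \<phi> \<psi>) \<longleftrightarrow> is_formula \<Sigma> \<phi> \<and> is_formula \<Sigma> \<psi>"
| "is_formula \<Sigma> (Disj \<phi> \<psi>) \<longleftrightarrow> is_formula \<Sigma> \<phi> \<and> is_formula \<Sigma> \<psi>"
| "is_formula \<Sigma> (Imp \<phi> \<psi>) \<longleftrightarrow> is_formula \<Sigma> \<phi> \<and> is_formula \<Sigma> \<psi>"
| "is_formula \<Sigma> (Exi \<tau> n \<phi>) \<longleftrightarrow> \<tau> \<in> Theta \<Sigma> \<and> is_formula \<Sigma> \<phi>"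
| "is_formula \<Sigma> (Uni \<tau> n \<phi>) \<longleftrightarrow> \<tau> \<in> Theta \<Sigma> \<and> is_formula \<Sigma> \<phi>"

definition language :: "'w gsignature \<Rightarrow> 'w form set" where
  "language \<Sigma> = {\<phi>. is_formula \<Sigma> \<phi>}"

text \<open>
  Values of first-order and second-order type are collected in one HOL type. Tuples in
  \<open>A\<^sup>n\<close> are lists of length \<open>n\<close>. The empty relation is the same value for every
  second-order type, which is harmless because types are tracked by the formulas.
\<close>

datatype 'a val = Elem (elem: 'a) | Reln (reln: "'a list set")

definition tuples :: "'a set \<Rightarrow> nat \<Rightarrow> 'a list set" where
  "tuples A n = {xs. length xs = n \<and> set xs \<subseteq> A}"

fun type_dom :: "'a set \<Rightarrow> so_type \<Rightarrow> 'a val set" where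
  "type_dom A Obj = Elem ` A"
| "type_dom A (Pred k) = Reln ` Pow (tuples A (Suc k))"

text \<open>\<open>geq U \<tau>\<close> is \<open>\<approx>\<^sub>\<tau>\<close>, and \<open>gbel U k\<close> is the generalized belonging relation for \<open>Pred k\<close>.\<close>

record ('a, 'w) gsystem =
  univ :: "'a set"
  cval :: "so_type \<Rightarrow> 'w \<Rightarrow> 'a val"
  geq :: "so_type \<Rightarrow> ('a val \<times> 'a val) set"
  gbel :: "nat \<Rightarrow> ('a list \<times> 'a list set) set"

definition is_gsystem :: "'w gsignature \<Rightarrow> ('a, 'w) gsystem \<Rightarrow> bool" where
  "is_gsystem \<Sigma> U \<longleftrightarrow>
     (\<forall>\<tau>\<in>Theta \<Sigma>. \<forall>\<omega>\<in>Omega \<Sigma> \<tau>. cval U \<tau> \<omega> \<in> type_dom (univ U) \<tau>) \<and>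
     (\<forall>\<tau>\<in>Theta \<Sigma>. geq U \<tau> \<subseteq> type_dom (univ U) \<tau> \<times> type_dom (univ U) \<tau> \<and>
        Id_on (type_dom (univ U) \<tau>) \<subseteq> geq U \<tau>) \<and>
     (\<forall>k. Pred k \<in> Theta \<Sigma> \<longrightarrow>
        gbel U k \<subseteq> tuples (univ U) (Suc k) \<times> Pow (tuples (univ U) (Suc k)) \<and>
        {(p, P). P \<subseteq> tuples (univ U) (Suc k) \<and> p \<in> P} \<subseteq> gbel U k)"

type_synonym 'a evaluation = "so_type \<Rightarrow> nat \<Rightarrow> 'a val"

definition is_evaluation ::
  "'w gsignature \<Rightarrow> ('a, 'w) gsystem \<Rightarrow> 'a evaluation \<Rightarrow> bool" where
  "is_evaluation \<Sigma> U \<gamma> \<longleftrightarrow> (\<forall>\<tau>\<in>Theta \<Sigma>. \<forall>n. \<gamma> \<tau> n \<in> type_dom (univ U) \<tau>)"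

definition agree_off :: "so_type \<Rightarrow> nat \<Rightarrow> 'a evaluation \<Rightarrow> 'a evaluation \<Rightarrow> bool" where
  "agree_off \<tau> n \<gamma> \<gamma>' \<longleftrightarrow> (\<forall>\<sigma> m. (\<sigma>, m) \<noteq> (\<tau>, n) \<longrightarrow> \<gamma>' \<sigma> m = \<gamma> \<sigma> m)"

primrec tval :: "('a, 'w) gsystem \<Rightarrow> 'a evaluation \<Rightarrow> 'w trm \<Rightarrow> 'a val" where
  "tval U \<gamma> (Var \<tau> n) = \<gamma> \<tau> n"
| "tval U \<gamma> (Cst \<tau> \<omega>) = cval U \<tau> \<omega>"

text \<open>
  Satisfaction is intended for formulas of the language only; the selectors \<open>elem\<close> and \<open>reln\<close>
  are then applied to values of the right kind.
\<close>

primrec sat :: "'w gsignature \<Rightarrow> ('a, 'w) gsystem \<Rightarrow> 'w form \<Rightarrow> 'a evaluation \<Rightarrow> bool" where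
  "sat \<Sigma> U (Eql \<tau> q r) = (\<lambda>\<gamma>. (tval U \<gamma> q, tval U \<gamma> r) \<in> geq U \<tau>)"
| "sat \<Sigma> U (Bel k qs r) =
     (\<lambda>\<gamma>. (map (\<lambda>q. elem (tval U \<gamma> q)) qs, reln (tval U \<gamma> r)) \<in> gbel U k)"
| "sat \<Sigma> U (Neg \<phi>) = (\<lambda>\<gamma>. \<not> sat \<Sigma> U \<phi> \<gamma>)"
| "sat \<Sigma> U (Conj \<phi> \<psi>) = (\<lambda>\<gamma>. sat \<Sigma> U \<phi> \<gamma> \<and> sat \<Sigma> U \<psi> \<gamma>)"
| "sat \<Sigma> U (Disj \<phi> \<psi>) = (\<lambda>\<gamma>. sat \<Sigma> U \<phi> \<gamma> \<or> sat \<Sigma> U \<psi> \<gamma>)"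
| "sat \<Sigma> U (Imp \<phi> \<psi>) = (\<lambda>\<gamma>. sat \<Sigma> U \<phi> \<gamma> \<longrightarrow> sat \<Sigma> U \<psi> \<gamma>)"
| "sat \<Sigma> U (Exi \<tau> n \<phi>) =
     (\<lambda>\<gamma>. \<exists>\<gamma>'. is_evaluation \<Sigma> U \<gamma>' \<and> agree_off \<tau> n \<gamma> \<gamma>' \<and> sat \<Sigma> U \<phi> \<gamma>')"
| "sat \<Sigma> U (Uni \<tau> n \<phi>) =
     (\<lambda>\<gamma>. \<forall>\<gamma>'. is_evaluation \<Sigma> U \<gamma>' \<and> agree_off \<tau> n \<gamma> \<gamma>' \<longrightarrow> sat \<Sigma> U \<phi> \<gamma>')"

definition is_model ::
  "'w gsignature \<Rightarrow> ('a, 'w) gsystem \<Rightarrow> 'a evaluation \<Rightarrow> 'w form set \<Rightarrow> bool" where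
  "is_model \<Sigma> U \<gamma> \<Gamma> \<longleftrightarrow>
     is_gsystem \<Sigma> U \<and> is_evaluation \<Sigma> U \<gamma> \<and> (\<forall>\<phi>\<in>\<Gamma>. sat \<Sigma> U \<phi> \<gamma>)"

definition E1 :: "so_type \<Rightarrow> 'w form" where
  "E1 \<tau> = Uni \<tau> 0 (Eql \<tau> (Var \<tau> 0) (Var \<tau> 0))"

definition E2 :: "so_type \<Rightarrow> 'w form" where
  "E2 \<tau> = Uni \<tau> 0 (Uni \<tau> 1
     (Imp (Eql \<tau> (Var \<tau> 0) (Var \<tau> 1)) (Eql \<tau> (Var \<tau> 1) (Var \<tau> 0))))"

definition E3 :: "so_type \<Rightarrow> 'w form" where
  "E3 \<tau> = Uni \<tau> 0 (Uni \<tau> 1 (Uni \<tau> 2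
     (Imp (Conj (Eql \<tau> (Var \<tau> 0) (Var \<tau> 1)) (Eql \<tau> (Var \<tau> 1) (Var \<tau> 2)))
       (Eql \<tau> (Var \<tau> 0) (Var \<tau> 2)))))"

text \<open>
  In \<open>E4 k\<close> the first-order variables \<open>x\<^sub>\<mu>\<close> and \<open>y\<^sub>\<mu>\<close> (\<open>\<mu> \<le> k\<close>) have the indices
  \<open>2 * \<mu>\<close> and \<open>2 * \<mu> + 1\<close>; the variables \<open>u\<close> and \<open>v\<close> of type \<open>Pred k\<close> have the indices
  \<open>0\<close> and \<open>1\<close>. The quantifier prefix is \<open>x\<^sub>0, y\<^sub>0, \<dots>, x\<^sub>k, y\<^sub>k, u, v\<close>, and the conjunction in
  the premise associates to the right.
\<close>

definition E4 :: "nat \<Rightarrow> 'w form" where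
  "E4 k =
    (let x = (\<lambda>\<mu>. Var Obj (2 * \<mu>)); y = (\<lambda>\<mu>. Var Obj (2 * \<mu> + 1));
         u = Var (Pred k) 0; v = Var (Pred k) 1
     in foldr (\<lambda>\<mu> \<phi>. Uni Obj (2 * \<mu>) (Uni Obj (2 * \<mu> + 1) \<phi>)) [0..<Suc k]
          (Uni (Pred k) 0 (Uni (Pred k) 1
            (Imp
              (foldr (\<lambda>\<mu> \<phi>. Conj (Eql Obj (x \<mu>) (y \<mu>)) \<phi>) [0..<Suc k] (Eql (Pred k) u v))
              (Iff (Bel k (map x [0..<Suc k]) u) (Bel k (map y [0..<Suc k]) v))))))"

definition equality_axioms :: "'w gsignature \<Rightarrow> 'w form set" where
  "equality_axioms \<Sigma> =
     {E1 \<tau> | \<tau>. \<tau> \<in> Theta \<Sigma>} \<union> {E2 \<tau> | \<tau>. \<tau> \<in> Theta \<Sigma>} \<union> {E3 \<tau> | \<tau>. \<tau> \<in> Theta \<Sigma>} \<union>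
     {E4 k | k. Pred k \<in> Theta \<Sigma>}"

end

theory Submission
  imports Defs
begin

text \<open>
  The model is an ultraproduct over the finite subsets of \<open>\<Phi>\<close>, but without passing to a quotient:
  its universe is the full product of the universes \<open>A\<^sub>i\<close>, and the generalized equalities and
  belonging relations hold when they hold in the factors for almost all coordinates. A second-order
  value of the product is an arbitrary set of tuples; it is sent to its coordinatewise images.
  Conversely, every family of relations \<open>P\<^sub>i\<close> is, for almost all \<open>i\<close>, the family of images of one
  set of tuples: of the empty set if almost all \<open>P\<^sub>i\<close> are empty, and otherwise of their product,
  with the few empty \<open>P\<^sub>i\<close> replaced by full relations. This lifting provides the values of constants and
  the witnesses in the existential step of Los's theorem.
\<close>

section \<open>Ultrafilters\<close>

text \<open>Zorn's lemma yields a minimal proper filter below \<open>F\<close>, and minimality makes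
  it decide every predicate.\<close>

lemma ultrafilter_below:
  fixes F :: "'i filter"
  assumes "F \<noteq> bot"
  obtains D where "D \<le> F" "D \<noteq> bot"
    "\<And>P. eventually P D \<or> eventually (\<lambda>i. \<not> P i) D"
proof -
  let ?A = "{G. G \<le> F \<and> G \<noteq> bot}"
  have "\<exists>D\<in>?A. \<forall>G\<in>?A. G \<le> D \<longrightarrow> G = D"
  proof (rule predicate_Zorn)
    show "partial_order_on ?A (relation_of (\<lambda>G H. H \<le> G) ?A)"
      by (auto simp: partial_order_on_def preorder_on_def refl_on_def trans_def antisym_def
          relation_of_def)
    fix C assume C: "C \<in> Chains (relation_of (\<lambda>G H. H \<le> G) ?A)"
    then have sub: "C \<subseteq> ?A" and lin: "\<And>G H. G \<in> C \<Longrightarrow> H \<in> C \<Longrightarrow> G \<le> H \<or> H \<le> G"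
      by (auto simp: Chains_def relation_of_def)
    show "\<exists>u\<in>?A. \<forall>a\<in>C. u \<le> a"
    proof (cases "C = {}")
      case True
      then show ?thesis using assms by auto
    next
      case False
      \<comment> \<open>A nonempty chain is a filter base: an event of \<open>Inf C\<close> is
        already an event of some member. So \<open>Inf C\<close> is proper because the members
        are.\<close>
      have "eventually P (Inf C) \<longleftrightarrow> (\<exists>b\<in>C. eventually P b)" for P
        using False by (rule eventually_Inf_base) (metis lin inf.orderE inf.absorb2 order_refl)
      then have "Inf C \<noteq> bot"
        using sub by (auto simp: trivial_limit_def)
      moreover have "Inf C \<le> F"
        using False sub by (metis (no_types, lifting) Inf_lower2 mem_Collect_eq subset_iff ex_in_conv)
      ultimately show ?thesis
        by (auto intro: Inf_lower)
    qed
  qed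
  then obtain D where D: "D \<le> F" "D \<noteq> bot"
    and min: "\<And>G. G \<le> D \<Longrightarrow> G \<noteq> bot \<Longrightarrow> G = D"
    by (auto dest: order_trans)
  \<comment> \<open>Restricting \<open>D\<close> to the set of \<open>P\<close> either collapses it,
    and then the complement is large, or by minimality changes nothing, and then \<open>P\<close> is
    large.\<close>
  have "eventually P D \<or> eventually (\<lambda>i. \<not> P i) D" for P
  proof (cases "inf D (principal {i. P i}) = bot")
    case True
    then show ?thesis
      by (simp add: trivial_limit_def eventually_inf_principal)
  next
    case False
    then have "inf D (principal {i. P i}) = D"
      by (intro min) auto
    then have "D \<le> principal {i. P i}"
      by (metis inf_le2)
    then show ?thesis
      by (simp add: le_principal)
  qed
  with D that show thesis by blast
qed

section \<open>Products of generalized second-order systems\<close>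

text \<open>On relations information is lost: different sets of tuples can have the same image at
  every coordinate. This is harmless, as generalized equality need not be the identity.\<close>

fun coord :: "'i \<Rightarrow> ('i \<Rightarrow> 'a) val \<Rightarrow> 'a val" where
  "coord i (Elem a) = Elem (a i)"
| "coord i (Reln P) = Reln (map (\<lambda>a. a i) ` P)"

locale system_family =
  fixes \<Sigma> :: "'w gsignature"
    and U :: "'i \<Rightarrow> ('a, 'w) gsystem"
    and D :: "'i filter"
  assumes system: "is_gsystem \<Sigma> (U i)"
    and nonempty: "univ (U i) \<noteq> {}"
    and proper: "D \<noteq> bot"
    and ultra: "eventually P D \<or> eventually (\<lambda>i. \<not> P i) D"
begin

definition prod_univ :: "('i \<Rightarrow> 'a) set" where
  "prod_univ = {a. \<forall>i. a i \<in> univ (U i)}"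

text \<open>The choice in \<open>cval\<close> is justified by \<open>prod_cval\<close>: for symbols
  of the signature a value with these coordinates exists.\<close>

definition prod_system :: "('i \<Rightarrow> 'a, 'w) gsystem" where
  "prod_system = \<lparr>univ = prod_univ,
     cval = (\<lambda>\<tau> \<omega>. SOME v. v \<in> type_dom prod_univ \<tau> \<and>
       (\<forall>\<^sub>F i in D. coord i v = cval (U i) \<tau> \<omega>)),
     geq = (\<lambda>\<tau>. {(v, w). v \<in> type_dom prod_univ \<tau> \<and> w \<in> type_dom prod_univ \<tau> \<and>
       (\<forall>\<^sub>F i in D. (coord i v, coord i w) \<in> geq (U i) \<tau>)}),
     gbel = (\<lambda>k. {(p, P). p \<in> tuples prod_univ (Suc k) \<and> P \<subseteq> tuples prod_univ (Suc k) \<and>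
       (\<forall>\<^sub>F i in D. (map (\<lambda>a. a i) p, map (\<lambda>a. a i) ` P) \<in> gbel (U i) k)})\<rparr>"

text \<open>
  Only pointwise: the exceptional set of coordinates may depend on the variable, and there are
  infinitely many variables.
\<close>

definition represents :: "('i \<Rightarrow> 'a) evaluation \<Rightarrow> ('i \<Rightarrow> 'a evaluation) \<Rightarrow> bool" where
  "represents \<gamma> g \<longleftrightarrow> is_evaluation \<Sigma> prod_system \<gamma> \<and> (\<forall>i. is_evaluation \<Sigma> (U i) (g i)) \<and>
     (\<forall>\<tau>\<in>Theta \<Sigma>. \<forall>n. \<forall>\<^sub>F i in D. coord i (\<gamma> \<tau> n) = g i \<tau> n)"

text \<open>The ultrafilter property enters the product construction only through this exchange with
  negation.\<close>

lemma eventually_not_iff: "(\<forall>\<^sub>F i in D. \<not> P i) \<longleftrightarrow> \<not> (\<forall>\<^sub>F i in D. P i)"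
proof
  assume "\<forall>\<^sub>F i in D. \<not> P i"
  then show "\<not> (\<forall>\<^sub>F i in D. P i)"
    using proper eventually_conj[of P D "\<lambda>i. \<not> P i"] by (auto simp: trivial_limit_def)
qed (use ultra in blast)

section \<open>Coordinates and the lifting of families of values\<close>

lemma coord_tuple:
  "p \<in> tuples prod_univ n \<Longrightarrow> map (\<lambda>a. a i) p \<in> tuples (univ (U i)) n"
  by (auto simp: tuples_def prod_univ_def)

lemma coord_type_dom:
  "v \<in> type_dom prod_univ \<tau> \<Longrightarrow> coord i v \<in> type_dom (univ (U i)) \<tau>"
proof (cases \<tau>)
  case (Pred k)
  assume "v \<in> type_dom prod_univ \<tau>"
  then obtain P where "v = Reln P" "P \<subseteq> tuples prod_univ (Suc k)"
    by (auto simp: Pred)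
  moreover from this have "map (\<lambda>a. a i) ` P \<subseteq> tuples (univ (U i)) (Suc k)"
    using coord_tuple by blast
  ultimately show ?thesis
    by (simp add: Pred)
qed (auto simp: prod_univ_def)

text \<open>A tuple from one \<open>Q i\<close> extends to a point of the product by choosing
  members of the other, nonempty \<open>Q j\<close>, so the projection is onto.\<close>

lemma image_coord_product:
  assumes "\<And>i. Q i \<noteq> {}" and "\<And>i. Q i \<subseteq> tuples (univ (U i)) n"
  shows "map (\<lambda>a. a i) ` {p \<in> tuples prod_univ n. \<forall>j. map (\<lambda>a. a j) p \<in> Q j} = Q i"
proof (intro equalityI subsetI)
  fix q assume q: "q \<in> Q i"
  \<comment> \<open>The choice is free except at \<open>i\<close>, where \<open>q\<close> is
    prescribed.\<close>
  define r where "r j = (if j = i then q else SOME x. x \<in> Q j)" for j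
  have r: "r j \<in> Q j" for j
    using q assms(1)[of j] by (auto simp: r_def some_in_eq)
  then have len: "length (r j) = n" and sub: "set (r j) \<subseteq> univ (U j)" for j
    using assms(2)[of j] by (auto simp: tuples_def)
  \<comment> \<open>Transposition: the family of tuples \<open>r j\<close> becomes one tuple of
    functions, whose entry \<open>\<mu>\<close> sends \<open>j\<close> to
    \<open>r j ! \<mu>\<close>.\<close>
  let ?p = "map (\<lambda>\<mu> j. r j ! \<mu>) [0..<n]"
  have "map (\<lambda>a. a j) ?p = r j" for j
    using len by (auto intro: nth_equalityI)
  moreover have "?p \<in> tuples prod_univ n"
    using sub len by (fastforce simp: tuples_def prod_univ_def)
  moreover have "r i = q" by (simp add: r_def)
  ultimately show "q \<in> map (\<lambda>a. a i) ` {p \<in> tuples prod_univ n. \<forall>j. map (\<lambda>a. a j) p \<in> Q j}"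
    using r by (intro image_eqI[of _ _ ?p]) auto
qed auto

text \<open>Agreement at all indices is out of reach: the image of a relation at a coordinate is
  empty only if the relation is, so no relation matches a family that mixes empty and nonempty
  ones.\<close>

lemma lift_values:
  assumes w: "\<And>i. w i \<in> type_dom (univ (U i)) \<tau>"
  obtains v where "v \<in> type_dom prod_univ \<tau>" "\<forall>\<^sub>F i in D. coord i v = w i"
proof (cases \<tau>)
  case Obj
  then have "\<forall>i. \<exists>a. a \<in> univ (U i) \<and> w i = Elem a"
    using w by auto
  then obtain a where "\<And>i. a i \<in> univ (U i)" "\<And>i. w i = Elem (a i)"
    by metis
  then show thesis
    by (intro that[of "Elem a"]) (auto simp: Obj prod_univ_def)
next
  case (Pred k)
  then have "\<forall>i. \<exists>P. P \<subseteq> tuples (univ (U i)) (Suc k) \<and> w i = Reln P"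
    using w by (simp add: image_iff Bex_def)
  then obtain P where P: "\<And>i. P i \<subseteq> tuples (univ (U i)) (Suc k)" "\<And>i. w i = Reln (P i)"
    by metis
  show thesis
  proof (cases "\<forall>\<^sub>F i in D. P i = {}")
    case True
    then show thesis
      by (intro that[of "Reln {}"]) (auto simp: Pred P(2) elim: eventually_mono)
  next
    case False
    \<comment> \<open>Full relations over nonempty universes are nonempty, so \<open>Q\<close> meets
      the demand of \<open>image_coord_product\<close>, and it differs from \<open>P\<close> only on
      a negligible set of indices.\<close>
    define Q where "Q i = (if P i = {} then tuples (univ (U i)) (Suc k) else P i)" for i
    let ?R = "{p \<in> tuples prod_univ (Suc k). \<forall>j. map (\<lambda>a. a j) p \<in> Q j}"
    have full: "tuples (univ (U i)) (Suc k) \<noteq> {}" for i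
    proof -
      obtain a where "a \<in> univ (U i)" using nonempty by blast
      then have "replicate (Suc k) a \<in> tuples (univ (U i)) (Suc k)"
        by (auto simp: tuples_def)
      then show ?thesis by blast
    qed
    have "map (\<lambda>a. a i) ` ?R = Q i" for i
      by (rule image_coord_product) (use full P(1) in \<open>auto simp: Q_def\<close>)
    moreover have "\<forall>\<^sub>F i in D. Q i = P i"
      using False unfolding eventually_not_iff[symmetric] by eventually_elim (simp add: Q_def)
    ultimately show thesis
      by (intro that[of "Reln ?R"]) (auto simp: Pred P(2))
  qed
qed

section \<open>The product as a generalized second-order system\<close>

lemma prod_cval:
  assumes "\<tau> \<in> Theta \<Sigma>" "\<omega> \<in> Omega \<Sigma> \<tau>"
  shows "cval prod_system \<tau> \<omega> \<in> type_dom prod_univ \<tau>"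
    and "\<forall>\<^sub>F i in D. coord i (cval prod_system \<tau> \<omega>) = cval (U i) \<tau> \<omega>"
proof -
  have "cval (U i) \<tau> \<omega> \<in> type_dom (univ (U i)) \<tau>" for i
    using system[of i] assms by (simp add: is_gsystem_def)
  from lift_values[of "\<lambda>i. cval (U i) \<tau> \<omega>", OF this]
  have "\<exists>v. v \<in> type_dom prod_univ \<tau> \<and> (\<forall>\<^sub>F i in D. coord i v = cval (U i) \<tau> \<omega>)"
    by blast
  from someI_ex[OF this]
  show "cval prod_system \<tau> \<omega> \<in> type_dom prod_univ \<tau>"
    and "\<forall>\<^sub>F i in D. coord i (cval prod_system \<tau> \<omega>) = cval (U i) \<tau> \<omega>"
    by (auto simp: prod_system_def)
qed

text \<open>At every index \<open>coord\<close> sends equal values to equal values, and members of a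
  relation to members of its image, so the lower bounds on \<open>geq\<close> and
  \<open>gbel\<close> are inherited from the factors.\<close>

lemma prod_system_is_gsystem: "is_gsystem \<Sigma> prod_system"
  unfolding is_gsystem_def
proof (intro conjI ballI allI impI)
  fix \<tau> \<omega> assume "\<tau> \<in> Theta \<Sigma>" "\<omega> \<in> Omega \<Sigma> \<tau>"
  then show "cval prod_system \<tau> \<omega> \<in> type_dom (univ prod_system) \<tau>"
    using prod_cval by (simp add: prod_system_def)
next
  fix \<tau> assume \<tau>: "\<tau> \<in> Theta \<Sigma>"
  show "geq prod_system \<tau> \<subseteq> type_dom (univ prod_system) \<tau> \<times> type_dom (univ prod_system) \<tau>"
    by (auto simp: prod_system_def)
  have "(coord i v, coord i v) \<in> geq (U i) \<tau>" if "v \<in> type_dom prod_univ \<tau>" for i v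
  proof -
    have "Id_on (type_dom (univ (U i)) \<tau>) \<subseteq> geq (U i) \<tau>"
      using system[of i] \<tau> by (simp add: is_gsystem_def)
    then show ?thesis
      using coord_type_dom[OF that] by blast
  qed
  then show "Id_on (type_dom (univ prod_system) \<tau>) \<subseteq> geq prod_system \<tau>"
    by (auto simp: prod_system_def)
next
  fix k assume k: "Pred k \<in> Theta \<Sigma>"
  show "gbel prod_system k
    \<subseteq> tuples (univ prod_system) (Suc k) \<times> Pow (tuples (univ prod_system) (Suc k))"
    by (auto simp: prod_system_def)
  have "(map (\<lambda>a. a i) p, map (\<lambda>a. a i) ` P) \<in> gbel (U i) k"
    if "P \<subseteq> tuples prod_univ (Suc k)" "p \<in> P" for i p P
  proof -
    have "map (\<lambda>a. a i) ` P \<subseteq> tuples (univ (U i)) (Suc k)"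
      using that(1) coord_tuple by blast
    moreover have "{(p, P). P \<subseteq> tuples (univ (U i)) (Suc k) \<and> p \<in> P} \<subseteq> gbel (U i) k"
      using system[of i] k by (simp add: is_gsystem_def)
    ultimately show ?thesis using that(2) by blast
  qed
  then show "{(p, P). P \<subseteq> tuples (univ prod_system) (Suc k) \<and> p \<in> P} \<subseteq> gbel prod_system k"
    by (auto simp: prod_system_def)
qed

section \<open>Los's theorem\<close>

lemma tval_type_dom:
  "term_of_type \<Sigma> \<tau> t \<Longrightarrow> represents \<gamma> g \<Longrightarrow> tval prod_system \<gamma> t \<in> type_dom prod_univ \<tau>"
  using prod_cval(1) by (cases t) (auto simp: represents_def is_evaluation_def prod_system_def)

lemma coord_tval:
  "term_of_type \<Sigma> \<tau> t \<Longrightarrow> represents \<gamma> g \<Longrightarrow>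
    \<forall>\<^sub>F i in D. coord i (tval prod_system \<gamma> t) = tval (U i) (g i) t"
  using prod_cval(2) by (cases t) (auto simp: represents_def)

text \<open>The quantifier step of Los's theorem. \<open>S\<close> and \<open>P\<close> are abstract
  so that it applies both to a formula and, for the universal quantifier, to its negation; the
  hypothesis on \<open>S\<close> is the induction hypothesis.\<close>

lemma represents_Exi:
  assumes \<tau>: "\<tau> \<in> Theta \<Sigma>" and rep: "represents \<gamma> g"
    and S: "\<And>\<gamma> g. represents \<gamma> g \<Longrightarrow> S \<gamma> \<longleftrightarrow> (\<forall>\<^sub>F i in D. P i (g i))"
  shows "(\<exists>\<gamma>'. is_evaluation \<Sigma> prod_system \<gamma>' \<and> agree_off \<tau> n \<gamma> \<gamma>' \<and> S \<gamma>') \<longleftrightarrow>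
      (\<forall>\<^sub>F i in D. \<exists>\<delta>. is_evaluation \<Sigma> (U i) \<delta> \<and> agree_off \<tau> n (g i) \<delta> \<and> P i \<delta>)"
    (is "?L \<longleftrightarrow> (\<forall>\<^sub>F i in D. \<exists>\<delta>. ?R i \<delta>)")
proof
  assume ?L
  then obtain \<gamma>' where \<gamma>': "is_evaluation \<Sigma> prod_system \<gamma>'" "agree_off \<tau> n \<gamma> \<gamma>'" "S \<gamma>'"
    by blast
  \<comment> \<open>Only the value at \<open>(\<tau>, n)\<close> changes, so everywhere else the
    representation is inherited from \<open>\<gamma>\<close> and \<open>g\<close>.\<close>
  define h where "h i = (g i)(\<tau> := (g i \<tau>)(n := coord i (\<gamma>' \<tau> n)))" for i
  have h: "is_evaluation \<Sigma> (U i) (h i)" "agree_off \<tau> n (g i) (h i)" for i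
    using rep \<gamma>'(1) \<tau> coord_type_dom
    by (auto simp: represents_def is_evaluation_def agree_off_def h_def prod_system_def)
  have "\<forall>\<^sub>F i in D. coord i (\<gamma>' \<sigma> m) = h i \<sigma> m" if "\<sigma> \<in> Theta \<Sigma>" for \<sigma> m
  proof (cases "(\<sigma>, m) = (\<tau>, n)")
    case True
    then show ?thesis by (simp add: h_def)
  next
    case False
    then have "\<gamma>' \<sigma> m = \<gamma> \<sigma> m" and "h i \<sigma> m = g i \<sigma> m" for i
      using \<gamma>'(2) h(2) by (simp_all add: agree_off_def)
    then show ?thesis using rep that by (simp add: represents_def)
  qed
  then have "represents \<gamma>' h"
    using \<gamma>'(1) h(1) by (simp add: represents_def)
  then have "\<forall>\<^sub>F i in D. P i (h i)"
    using S \<gamma>'(3) by blast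
  then show "\<forall>\<^sub>F i in D. \<exists>\<delta>. ?R i \<delta>"
    by eventually_elim (use h in blast)
next
  assume ev: "\<forall>\<^sub>F i in D. \<exists>\<delta>. ?R i \<delta>"
  \<comment> \<open>The fallback \<open>g i\<close> makes \<open>h i\<close> an evaluation agreeing
    with \<open>g i\<close> off the variable at every index, as \<open>lift_values\<close> needs
    values of the right type everywhere.\<close>
  define h where "h i = (if \<exists>\<delta>. ?R i \<delta> then SOME \<delta>. ?R i \<delta> else g i)" for i
  have hR: "?R i (h i)" if "\<exists>\<delta>. ?R i \<delta>" for i
    using someI_ex[OF that] that by (simp add: h_def)
  have h: "is_evaluation \<Sigma> (U i) (h i) \<and> agree_off \<tau> n (g i) (h i)" for i
  proof (cases "\<exists>\<delta>. ?R i \<delta>")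
    case True
    then show ?thesis using hR by blast
  next
    case False
    then have "h i = g i" unfolding h_def by (rule if_not_P)
    then show ?thesis using rep by (simp add: represents_def agree_off_def)
  qed
  then have "h i \<tau> n \<in> type_dom (univ (U i)) \<tau>" for i
    using \<tau> by (simp add: is_evaluation_def)
  then obtain v where v: "v \<in> type_dom prod_univ \<tau>" "\<forall>\<^sub>F i in D. coord i v = h i \<tau> n"
    by (rule lift_values)
  \<comment> \<open>A single value has to be lifted, since \<open>h\<close> and \<open>g\<close>
    agree at all other variables.\<close>
  define \<gamma>' where "\<gamma>' = \<gamma>(\<tau> := (\<gamma> \<tau>)(n := v))"
  have eval: "is_evaluation \<Sigma> prod_system \<gamma>'"
    using rep v(1) by (auto simp: represents_def is_evaluation_def \<gamma>'_def prod_system_def)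
  have "\<forall>\<^sub>F i in D. coord i (\<gamma>' \<sigma> m) = h i \<sigma> m" if "\<sigma> \<in> Theta \<Sigma>" for \<sigma> m
  proof (cases "(\<sigma>, m) = (\<tau>, n)")
    case True
    then show ?thesis using v(2) by (simp add: \<gamma>'_def)
  next
    case False
    then have "h i \<sigma> m = g i \<sigma> m" for i
      using h by (simp add: agree_off_def)
    then show ?thesis using False rep that by (auto simp: \<gamma>'_def represents_def)
  qed
  then have "represents \<gamma>' h"
    using eval h by (simp add: represents_def)
  moreover have "\<forall>\<^sub>F i in D. P i (h i)"
    using ev by eventually_elim (use hR in blast)
  ultimately have "S \<gamma>'"
    using S by blast
  moreover have "agree_off \<tau> n \<gamma> \<gamma>'"
    by (auto simp: agree_off_def \<gamma>'_def)
  ultimately show ?L using eval by blast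
qed

text \<open>Pointwise representation suffices because an atomic formula has finitely many terms and
  a quantifier changes one value. The evaluations stay arbitrary in the induction for the sake of
  the quantifiers.\<close>

theorem Los:
  assumes "is_formula \<Sigma> \<phi>" "represents \<gamma> g"
  shows "sat \<Sigma> prod_system \<phi> \<gamma> \<longleftrightarrow> (\<forall>\<^sub>F i in D. sat \<Sigma> (U i) \<phi> (g i))"
  using assms
proof (induction \<phi> arbitrary: \<gamma> g)
  case (Eql \<tau> q r)
  then have q: "term_of_type \<Sigma> \<tau> q" and r: "term_of_type \<Sigma> \<tau> r"
    by simp_all
  have "\<forall>\<^sub>F i in D. (coord i (tval prod_system \<gamma> q), coord i (tval prod_system \<gamma> r)) \<in> geq (U i) \<tau>
      \<longleftrightarrow> sat \<Sigma> (U i) (Eql \<tau> q r) (g i)"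
    using coord_tval[OF q Eql.prems(2)] coord_tval[OF r Eql.prems(2)] by eventually_elim simp
  from eventually_subst[OF this] show ?case
    using tval_type_dom[OF q Eql.prems(2)] tval_type_dom[OF r Eql.prems(2)]
    by (simp add: prod_system_def)
next
  case (Bel k qs r)
  let ?p = "map (\<lambda>q. elem (tval prod_system \<gamma> q)) qs"
  have qs: "\<And>q. q \<in> set qs \<Longrightarrow> term_of_type \<Sigma> Obj q" and r: "term_of_type \<Sigma> (Pred k) r"
    and len: "length qs = Suc k"
    using Bel.prems by auto
  have q_dom: "tval prod_system \<gamma> q \<in> Elem ` prod_univ" if "q \<in> set qs" for q
    using tval_type_dom[OF qs[OF that] Bel.prems(2)] by simp
  then have p: "?p \<in> tuples prod_univ (Suc k)"
    using len by (fastforce simp: tuples_def)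
  obtain P where P: "tval prod_system \<gamma> r = Reln P" "P \<subseteq> tuples prod_univ (Suc k)"
    using tval_type_dom[OF r Bel.prems(2)] by auto
  \<comment> \<open>The finitely many exceptional sets of the terms in \<open>qs\<close> combine
    into one.\<close>
  have "\<forall>\<^sub>F i in D. \<forall>q\<in>set qs. coord i (tval prod_system \<gamma> q) = tval (U i) (g i) q"
    using coord_tval[OF _ Bel.prems(2)] qs by (intro eventually_ball_finite) blast+
  then have iff: "\<forall>\<^sub>F i in D. (map (\<lambda>a. a i) ?p, map (\<lambda>a. a i) ` P) \<in> gbel (U i) k
      \<longleftrightarrow> sat \<Sigma> (U i) (Bel k qs r) (g i)"
    using coord_tval[OF r Bel.prems(2)]
  proof eventually_elim
    fix i
    assume q: "\<forall>q\<in>set qs. coord i (tval prod_system \<gamma> q) = tval (U i) (g i) q"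
      and "coord i (tval prod_system \<gamma> r) = tval (U i) (g i) r"
    then have "reln (tval (U i) (g i) r) = map (\<lambda>a. a i) ` P"
      by (metis P(1) coord.simps(2) val.sel(2))
    moreover have "elem (tval (U i) (g i) q) = elem (tval prod_system \<gamma> q) i"
      if "q \<in> set qs" for q
    proof -
      \<comment> \<open>Typing makes the value an \<open>Elem\<close>, where \<open>elem\<close>
        commutes with taking coordinates.\<close>
      have "elem (coord i (tval prod_system \<gamma> q)) = elem (tval prod_system \<gamma> q) i"
        using q_dom[OF that] by auto
      then show ?thesis using q that by simp
    qed
    then have "map (\<lambda>q. elem (tval (U i) (g i) q)) qs = map (\<lambda>a. a i) ?p"
      by simp
    ultimately show "(map (\<lambda>a. a i) ?p, map (\<lambda>a. a i) ` P) \<in> gbel (U i) k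
        \<longleftrightarrow> sat \<Sigma> (U i) (Bel k qs r) (g i)"
      unfolding sat.simps by (simp only:)
  qed
  have "sat \<Sigma> prod_system (Bel k qs r) \<gamma> \<longleftrightarrow> (?p, P) \<in> gbel prod_system k"
    by (simp add: P(1))
  also have "\<dots> \<longleftrightarrow> (\<forall>\<^sub>F i in D. (map (\<lambda>a. a i) ?p, map (\<lambda>a. a i) ` P) \<in> gbel (U i) k)"
    using p P(2) unfolding prod_system_def by simp
  also note eventually_subst[OF iff]
  finally show ?case .
next
  case (Neg \<phi>)
  then show ?case by (simp add: eventually_not_iff)
next
  case (Conj \<phi> \<psi>)
  then show ?case by (simp add: eventually_conj_iff)
next
  case (Disj \<phi> \<psi>)
  let ?s = "\<lambda>\<chi> i. sat \<Sigma> (U i) \<chi> (g i)"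
  \<comment> \<open>De Morgan reduces disjunction to conjunction and negation, both of which commute
    with the ultrafilter.\<close>
  have "(\<forall>\<^sub>F i in D. ?s \<phi> i \<or> ?s \<psi> i) \<longleftrightarrow> \<not> (\<forall>\<^sub>F i in D. \<not> ?s \<phi> i \<and> \<not> ?s \<psi> i)"
    unfolding eventually_not_iff[symmetric] by simp
  with Disj show ?case by (simp add: eventually_conj_iff eventually_not_iff)
next
  case (Imp \<phi> \<psi>)
  let ?s = "\<lambda>\<chi> i. sat \<Sigma> (U i) \<chi> (g i)"
  have "(\<forall>\<^sub>F i in D. ?s \<phi> i \<longrightarrow> ?s \<psi> i) \<longleftrightarrow> \<not> (\<forall>\<^sub>F i in D. ?s \<phi> i \<and> \<not> ?s \<psi> i)"
    unfolding eventually_not_iff[symmetric] by simp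
  with Imp show ?case by (simp add: eventually_conj_iff eventually_not_iff)
next
  case (Exi \<tau> n \<phi>)
  then show ?case
    using represents_Exi[of \<tau> \<gamma> g "sat \<Sigma> prod_system \<phi>" "\<lambda>i. sat \<Sigma> (U i) \<phi>" n] by simp
next
  case (Uni \<tau> n \<phi>)
  \<comment> \<open>The universal quantifier is treated as the negation of an existential one over
    the negated formula.\<close>
  then have "(\<exists>\<gamma>'. is_evaluation \<Sigma> prod_system \<gamma>' \<and> agree_off \<tau> n \<gamma> \<gamma>' \<and>
        \<not> sat \<Sigma> prod_system \<phi> \<gamma>') \<longleftrightarrow>
      (\<forall>\<^sub>F i in D. \<exists>\<delta>. is_evaluation \<Sigma> (U i) \<delta> \<and> agree_off \<tau> n (g i) \<delta> \<and>
        \<not> sat \<Sigma> (U i) \<phi> \<delta>)"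
    by (intro represents_Exi) (auto simp: eventually_not_iff)
  also have "\<dots> \<longleftrightarrow> (\<forall>\<^sub>F i in D. \<not> sat \<Sigma> (U i) (Uni \<tau> n \<phi>) (g i))"
    by simp
  also have "\<dots> \<longleftrightarrow> \<not> (\<forall>\<^sub>F i in D. sat \<Sigma> (U i) (Uni \<tau> n \<phi>) (g i))"
    by (rule eventually_not_iff)
  finally show ?case by auto
qed

lemma represents_ex:
  assumes "\<And>i. is_evaluation \<Sigma> (U i) (g i)"
  obtains \<gamma> where "represents \<gamma> g"
proof -
  \<comment> \<open>Each variable is lifted separately, with its own exceptional set; types outside
    the signature may get any value.\<close>
  have "\<exists>v. \<tau> \<in> Theta \<Sigma> \<longrightarrow> v \<in> type_dom prod_univ \<tau> \<and> (\<forall>\<^sub>F i in D. coord i v = g i \<tau> n)" for \<tau> n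
  proof (cases "\<tau> \<in> Theta \<Sigma>")
    case True
    then have "g i \<tau> n \<in> type_dom (univ (U i)) \<tau>" for i
      using assms by (simp add: is_evaluation_def)
    then show ?thesis by (rule lift_values) blast
  qed simp
  then obtain \<gamma> where "\<And>\<tau> n. \<tau> \<in> Theta \<Sigma> \<Longrightarrow>
      \<gamma> \<tau> n \<in> type_dom prod_univ \<tau> \<and> (\<forall>\<^sub>F i in D. coord i (\<gamma> \<tau> n) = g i \<tau> n)"
    by metis
  then show thesis
    using assms by (intro that[of \<gamma>]) (auto simp: represents_def is_evaluation_def prod_system_def)
qed

end

section \<open>Compactness\<close>

lemma is_formula_foldr_Uni:
  "Obj \<in> Theta \<Sigma> \<Longrightarrow>
    is_formula \<Sigma> (foldr (\<lambda>\<mu> \<phi>. Uni Obj (a \<mu>) (Uni Obj (b \<mu>) \<phi>)) xs \<psi>) \<longleftrightarrow> is_formula \<Sigma> \<psi>"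
  by (induction xs) auto

lemma is_formula_foldr_Conj:
  "is_formula \<Sigma> (foldr (\<lambda>\<mu> \<phi>. Conj (f \<mu>) \<phi>) xs \<psi>) \<longleftrightarrow>
    (\<forall>\<mu>\<in>set xs. is_formula \<Sigma> (f \<mu>)) \<and> is_formula \<Sigma> \<psi>"
  by (induction xs) auto

text \<open>Los's theorem covers only formulas of the language, so the axioms must be checked to
  belong to it.\<close>

lemma equality_axioms_language:
  assumes "Obj \<in> Theta \<Sigma>"
  shows "equality_axioms \<Sigma> \<subseteq> language \<Sigma>"
  using assms
  by (auto simp: equality_axioms_def language_def E1_def E2_def E3_def E4_def Let_def Iff_def
      is_formula_foldr_Uni is_formula_foldr_Conj simp del: upt_Suc)

theorem theorem3:
  fixes \<Sigma> :: "'w gsignature" and \<Phi> \<Psi> :: "'w form set"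
  assumes "is_gsignature \<Sigma>"
    and "\<Phi> \<subseteq> language \<Sigma>"
    and "\<Psi> \<subseteq> language \<Sigma>"
    and "\<forall>f. finite f \<and> f \<subseteq> \<Phi> \<longrightarrow>
      (\<exists>(U :: ('a, 'w) gsystem) \<gamma>. is_model \<Sigma> U \<gamma> (f \<union> equality_axioms \<Sigma> \<union> \<Psi>))"
  shows "\<exists>(U :: ('w form set \<Rightarrow> 'a, 'w) gsystem) \<gamma>.
      is_model \<Sigma> U \<gamma> (\<Phi> \<union> equality_axioms \<Sigma> \<union> \<Psi>)"
proof -
  let ?\<Gamma> = "equality_axioms \<Sigma> \<union> \<Psi>"
  \<comment> \<open>Below this filter, the finite subsets of \<open>\<Phi>\<close> that contain a
    given formula of \<open>\<Phi>\<close> form a large set.\<close>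
  obtain D :: "'w form set filter" where D: "D \<le> finite_subsets_at_top \<Phi>" "D \<noteq> bot"
    and ultra: "\<And>P. eventually P D \<or> eventually (\<lambda>f. \<not> P f) D"
    using ultrafilter_below[OF finite_subsets_at_top_neq_bot] by blast
  \<comment> \<open>The indices are arbitrary sets of formulas; those that are not finite subsets of
    \<open>\<Phi>\<close> are treated as the empty set, so that every index has a model.\<close>
  define fin where "fin f = (if finite f \<and> f \<subseteq> \<Phi> then f else {})" for f
  have "finite (fin f) \<and> fin f \<subseteq> \<Phi>" for f
    by (auto simp: fin_def)
  then have "\<forall>f. \<exists>(U :: ('a, 'w) gsystem) \<gamma>. is_model \<Sigma> U \<gamma> (fin f \<union> ?\<Gamma>)"
    using assms(4) by (simp add: Un_assoc)
  then obtain U :: "'w form set \<Rightarrow> ('a, 'w) gsystem" and g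
    where U: "\<And>f. is_model \<Sigma> (U f) (g f) (fin f \<union> ?\<Gamma>)"
    by metis
  have g: "is_evaluation \<Sigma> (U f) (g f)" for f
    using U by (simp add: is_model_def)
  have Obj: "Obj \<in> Theta \<Sigma>"
    using assms(1) by (simp add: is_gsignature_def)
  \<comment> \<open>The evaluation gives a value to a first-order variable, hence an element of the
    universe.\<close>
  have "univ (U f) \<noteq> {}" for f
    using g[of f] Obj by (force simp: is_evaluation_def)
  then interpret system_family \<Sigma> U D
    using U D(2) ultra by unfold_locales (auto simp: is_model_def)
  obtain \<gamma> where \<gamma>: "represents \<gamma> g"
    using represents_ex[OF g] .
  have "\<forall>\<^sub>F f in D. sat \<Sigma> (U f) \<phi> (g f)" if "\<phi> \<in> \<Phi> \<union> ?\<Gamma>" for \<phi>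
  proof (cases "\<phi> \<in> ?\<Gamma>")
    case True
    then show ?thesis using U by (auto simp: is_model_def intro!: always_eventually)
  next
    case False
    then have "\<forall>\<^sub>F f in finite_subsets_at_top \<Phi>. \<phi> \<in> fin f"
      using that unfolding eventually_finite_subsets_at_top
      by (intro exI[of _ "{\<phi>}"]) (auto simp: fin_def)
    then have "\<forall>\<^sub>F f in D. \<phi> \<in> fin f"
      using D(1) by (rule filter_leD[rotated])
    then show ?thesis
      by eventually_elim (use U in \<open>auto simp: is_model_def\<close>)
  qed
  moreover have "is_formula \<Sigma> \<phi>" if "\<phi> \<in> \<Phi> \<union> ?\<Gamma>" for \<phi>
    using that assms(2,3) equality_axioms_language[OF Obj] by (auto simp: language_def)
  ultimately have "is_model \<Sigma> prod_system \<gamma> (\<Phi> \<union> ?\<Gamma>)"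
    using prod_system_is_gsystem Los[OF _ \<gamma>] \<gamma> by (simp add: is_model_def represents_def)
  then show ?thesis
    by (metis Un_assoc)
qed

end
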